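(* Let $a_\dagger>0$ and $T>0$ be fixed, and let $d=d(x,s)$ and $B=B(x,s)$ be non-negative. Assume that $d$, $B$, $\psi_1$, $\psi_2$ are sufficiently smooth such that the solution $u$ to the problem (P) given in the context is thrice continuously differentiable with bounded derivatives. Moreover, assume that there exists $L>0$ such that for every $0\le x\le a_\dagger$ and $s_1,s_2>0$, $$|d(x,s_1)-d(x,s_2)|\le L|s_1-s_2|\quad\text{and}\quad |B(x,s_1)-B(x,s_2)|\le L|s_1-s_2|.$$ Let $r$ and $\lambda$ be such that $k=rh^2=\lambda h$ with $\lambda+2r\le1$. Then the discretization $\Phi_h(\boldsymbol U_h)=\boldsymbol 0$ (with $\Phi_h$, $X_h$, $Y_h$, their norms and $\boldsymbol u_h$ as in the context) is stable with thresholds $R_h=Rh$, where $R$ is a fixed positive constant; that is, there exist two positive constants $h_0$ and $S$ such that for all $h\le h_0$ and for all $\boldsymbol V_h,\boldsymbol W_h$ in the open ball $B(\boldsymbol u_h,R_h)$ in $X_h$ with center $\boldsymbol u_h$ and radius $R_h$, $$\|\boldsymbol V_h-\boldsymbol W_h\|_{X_h}\le S\,\|\Phi_h(\boldsymbol V_h)-\Phi_h(\boldsymbol W_h)\|_{Y_h}.$$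
   Context: Problem (P), for the unknown $u(x,t)$, with given functions $d(x,s)$, $B(x,s)$, $\psi_1(x)$, $\psi_2(x)$, $u_0(x)$: $$\begin{aligned}&u_t(x,t)+u_x(x,t)+d(x,s_1(t))\,u(x,t)=u_{xx}(x,t),\quad x\in(0,a_\dagger),\ t>0,\\ &u(0,t)-u_x(0,t)=\int_0^{a_\dagger}B(x,s_2(t))\,u(x,t)\,dx,\quad t\ge0,\\ &u(a_\dagger,t)=0,\quad t\ge0,\\ &u(x,0)=u_0(x),\quad x\in(0,a_\dagger),\\ &s_i(t)=\int_0^{a_\dagger}\psi_i(x)u(x,t)\,dx,\quad t\ge0,\ i=1,2.\end{aligned}$$ Grid. $h,k>0$ are the spatial and temporal step sizes, with $a_\dagger=Mh$, $M=2(M'+3)$ for some $M'\in\mathbb N$, and $T=Nk$ for some $N\in\mathbb N$. Put $x_i=ih$, $t_n=nk$. Notation. For $\boldsymbol V=(V_1,\dots,V_{M-1})$ and $\boldsymbol W=(W_1,\dots,W_{M-1})$ in $\mathbb R^{M-1}$, $\boldsymbol V\cdot\boldsymbol W=(V_1W_1,\dots,V_{M-1}W_{M-1})$ is the componentwise product, and $$\mathcal Q_h(\boldsymbol V)=\tfrac{4h}{3}(2V_1-V_2+2V_3)+\tfrac h3\sum_{i=2}^{M'}(V_{2i}+4V_{2i+1}+V_{2i+2})+\tfrac{4h}{3}(2V_{2M'+3}-V_{2M'+4}+2V_{2M'+5}).$$ For $j=1,2$, $\boldsymbol\Psi_j=(\psi_j(x_1),\dots,\psi_j(x_{M-1}))$;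 $d_i(s)=d(x_i,s)$ and $\boldsymbol B(s)=(B(x_1,s),\dots,B(x_{M-1},s))$. Spaces and operator. $X_h=Y_h=\mathbb R^{N+1}\times(\mathbb R^{M-1})^{N+1}\times\mathbb R^{N+1}$. An element of $X_h$ is written $(\boldsymbol V_0,\boldsymbol V^0,\dots,\boldsymbol V^N,\boldsymbol V_M)$ with $\boldsymbol V_0=(V_0^0,\dots,V_0^N)$, $\boldsymbol V^n=(V_1^n,\dots,V_{M-1}^n)$, $\boldsymbol V_M=(V_M^0,\dots,V_M^N)$; similarly for $Y_h$. $\boldsymbol U^0=(U_1^0,\dots,U_{M-1}^0)$ is the initial vector of the numerical scheme, set there to $U_i^0=u_0(x_i)$. The map $\Phi_h\colon X_h\to Y_h$ sends $(\boldsymbol V_0,\boldsymbol V^0,\dots,\boldsymbol V^N,\boldsymbol V_M)$ to $(\boldsymbol P_0,\boldsymbol P^0,\dots,\boldsymbol P^N,\boldsymbol P_M)$, where $$\begin{aligned}P_0^n&=\left(1+\tfrac1h\right)V_0^n-\tfrac1hV_1^n-\mathcal Q_h\Big(\boldsymbol B\big(\mathcal Q_h(\boldsymbol\Psi_2\cdot\boldsymbol V^n)\big)\cdot\boldsymbol V^n\Big),\quad 0\le n\le N,\\ P_M^n&=\frac{V_M^n}{h},\quad 0\le n\le N,\\ P_i^0&=V_i^0-U_i^0,\quad 1\le i\le M-1,\\ P_i^n&=\frac{V_i^n-V_i^{n-1}}{k}+\frac{V_i^{n-1}-V_{i-1}^{n-1}}{h}+d_i\big(\mathcal Q_h(\boldsymbol\Psi_1\cdot\boldsymbol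 V^{n-1})\big)V_i^{n-1}-\frac{V_{i+1}^{n-1}+V_{i-1}^{n-1}-2V_i^{n-1}}{h^2},\quad 1\le n\le N,\ 1\le i\le M-1.\end{aligned}$$ Norms. $\|\boldsymbol V\|^2=\sum_{i=1}^{M-1}h|V_i|^2$ for $\boldsymbol V\in\mathbb R^{M-1}$; $\|\boldsymbol Z\|_*^2=\sum_{n=0}^Nk|Z^n|^2$ for $\boldsymbol Z=(Z^0,\dots,Z^N)\in\mathbb R^{N+1}$; and $$\|(\boldsymbol V_0,\boldsymbol V^0,\dots,\boldsymbol V^N,\boldsymbol V_M)\|_{X_h}=h\big(\|\boldsymbol V_0\|_*+\|\boldsymbol V_M\|_*\big)+\max_{0\le n\le N}\|\boldsymbol V^n\|,$$ $$\|(\boldsymbol P_0,\boldsymbol P^0,\dots,\boldsymbol P^N,\boldsymbol P_M)\|_{Y_h}=\Big(\|\boldsymbol P_0\|_*^2+\|\boldsymbol P^0\|^2+h\|\boldsymbol P_M\|_*^2+\sum_{n=1}^Nk\|\boldsymbol P^n\|^2\Big)^{1/2}.$$ Discrete representation of $u$. $\boldsymbol u_h=(\boldsymbol u_0,\boldsymbol u^0,\dots,\boldsymbol u^N,\boldsymbol u_M)\in X_h$ consists of the nodal values: $\boldsymbol u_0=(u(0,t_n))_{0\le n\le N}$, $\boldsymbol u^n=(u(x_i,t_n))_{1\le i\le M-1}$, $\boldsymbol u_M=(u(a_\dagger,t_n))_{0\le n\le N}$. (The vector $\boldsymbol u_0$ is not to be confused with the initial function $u_0$.) *)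

theory Defs
  imports "HOL-Analysis.Analysis"
begin

text \<open>\<open>D i j\<close> is the partial derivative of order \<open>i\<close> in the first and \<open>j\<close> in the second
  variable. Derivatives are taken within \<open>X\<close> and \<open>Y\<close>, hence one-sided at the end points of a
  closed interval.\<close>

definition partials_upto ::
  "nat \<Rightarrow> real set \<Rightarrow> real set \<Rightarrow> (real \<Rightarrow> real \<Rightarrow> real) \<Rightarrow> (nat \<Rightarrow> nat \<Rightarrow> real \<Rightarrow> real \<Rightarrow> real) \<Rightarrow> bool"
where
  "partials_upto m X Y f D \<longleftrightarrow>
     (\<forall>x\<in>X. \<forall>y\<in>Y. D 0 0 x y = f x y) \<and>
     (\<forall>i j. i + j \<le> m \<longrightarrow> continuous_on (X \<times> Y) (\<lambda>(x, y). D i j x y)) \<and>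
     (\<forall>i j. i + j < m \<longrightarrow> (\<forall>x\<in>X. \<forall>y\<in>Y.
        ((\<lambda>\<xi>. D i j \<xi> y) has_real_derivative D (Suc i) j x y) (at x within X) \<and>
        ((\<lambda>\<eta>. D i j x \<eta>) has_real_derivative D i (Suc j) x y) (at y within Y)))"

definition cont_diff2 :: "nat \<Rightarrow> real set \<Rightarrow> real set \<Rightarrow> (real \<Rightarrow> real \<Rightarrow> real) \<Rightarrow> bool" where
  "cont_diff2 m X Y f \<longleftrightarrow> (\<exists>D. partials_upto m X Y f D)"

definition cont_diff2_bounded :: "nat \<Rightarrow> real set \<Rightarrow> real set \<Rightarrow> (real \<Rightarrow> real \<Rightarrow> real) \<Rightarrow> bool" where
  "cont_diff2_bounded m X Y f \<longleftrightarrow>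
     (\<exists>D. partials_upto m X Y f D \<and>
        (\<forall>i j. 0 < i + j \<and> i + j \<le> m \<longrightarrow> bounded ((\<lambda>(x, y). D i j x y) ` (X \<times> Y))))"

text \<open>In contrast to \<open>C1_differentiable_on\<close>, one-sided derivatives are used at end points.\<close>

definition cont_diff1 :: "real set \<Rightarrow> (real \<Rightarrow> real) \<Rightarrow> bool" where
  "cont_diff1 X f \<longleftrightarrow>
     (\<exists>f'. continuous_on X f' \<and> (\<forall>x\<in>X. (f has_real_derivative f' x) (at x within X)))"

text \<open>\<open>ux\<close>, \<open>uxx\<close>, \<open>ut\<close> are the derivatives of \<open>u\<close>. The integrals are stated with
  \<open>has_integral\<close>, so that their existence is part of being a solution.\<close>

definition solves_P ::
  "real \<Rightarrow> (real \<Rightarrow> real \<Rightarrow> real) \<Rightarrow> (real \<Rightarrow> real \<Rightarrow> real) \<Rightarrow> (real \<Rightarrow> real) \<Rightarrow> (real \<Rightarrow> real) \<Rightarrow>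
   (real \<Rightarrow> real) \<Rightarrow> (real \<Rightarrow> real \<Rightarrow> real) \<Rightarrow> bool"
where
  "solves_P a d B \<psi>1 \<psi>2 u0 u \<longleftrightarrow>
     (\<exists>s1 s2 ut ux uxx.
        (\<forall>t\<ge>0. ((\<lambda>x. \<psi>1 x * u x t) has_integral s1 t) {0..a}) \<and>
        (\<forall>t\<ge>0. ((\<lambda>x. \<psi>2 x * u x t) has_integral s2 t) {0..a}) \<and>
        (\<forall>x\<in>{0<..<a}. \<forall>t>0.
           ((\<lambda>\<tau>. u x \<tau>) has_real_derivative ut x t) (at t) \<and>
           ((\<lambda>\<xi>. u \<xi> t) has_real_derivative ux x t) (at x) \<and>
           ((\<lambda>\<xi>. ux \<xi> t) has_real_derivative uxx x t) (at x) \<and>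
           ut x t + ux x t + d x (s1 t) * u x t = uxx x t) \<and>
        (\<forall>t\<ge>0.
           ((\<lambda>\<xi>. u \<xi> t) has_real_derivative ux 0 t) (at 0 within {0..a}) \<and>
           ((\<lambda>x. B x (s2 t) * u x t) has_integral (u 0 t - ux 0 t)) {0..a}) \<and>
        (\<forall>t\<ge>0. u a t = 0) \<and>
        (\<forall>x\<in>{0<..<a}. u x 0 = u0 x))"

text \<open>An element \<open>(V0, V, VM)\<close> has \<open>V0 n\<close>, \<open>V n i\<close>, \<open>VM n\<close> as the values at the nodes
  \<open>(x\<^sub>0, t\<^sub>n)\<close>, \<open>(x\<^sub>i, t\<^sub>n)\<close> with \<open>1 \<le> i \<le> M - 1\<close>, and \<open>(x\<^sub>M, t\<^sub>n)\<close>, for \<open>0 \<le> n \<le> N\<close>.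
  Values at all other indices are irrelevant: they enter neither the norms nor those components of
  \<open>Phi\<close> that the norms see.
  Subtraction on this type is componentwise.\<close>

type_synonym grid_fun = "(nat \<Rightarrow> real) \<times> (nat \<Rightarrow> nat \<Rightarrow> real) \<times> (nat \<Rightarrow> real)"

definition cells :: "nat \<Rightarrow> nat" where
  "cells M' = 2 * (M' + 3)"

definition Qh :: "real \<Rightarrow> nat \<Rightarrow> (nat \<Rightarrow> real) \<Rightarrow> real" where
  "Qh h M' V =
     4 * h / 3 * (2 * V 1 - V 2 + 2 * V 3)
     + h / 3 * (\<Sum>i = 2..M'. V (2*i) + 4 * V (2*i + 1) + V (2*i + 2))
     + 4 * h / 3 * (2 * V (2*M' + 3) - V (2*M' + 4) + 2 * V (2*M' + 5))"

text \<open>The value at node \<open>(x\<^sub>i, t\<^sub>n)\<close>, \<open>0 \<le> i \<le> M\<close>, boundary nodes included.\<close>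

fun node :: "nat \<Rightarrow> grid_fun \<Rightarrow> nat \<Rightarrow> nat \<Rightarrow> real" where
  "node M (V0, V, VM) n i = (if i = 0 then V0 n else if i = M then VM n else V n i)"

definition Phi ::
  "(real \<Rightarrow> real \<Rightarrow> real) \<Rightarrow> (real \<Rightarrow> real \<Rightarrow> real) \<Rightarrow> (real \<Rightarrow> real) \<Rightarrow> (real \<Rightarrow> real) \<Rightarrow>
   (real \<Rightarrow> real) \<Rightarrow> real \<Rightarrow> real \<Rightarrow> nat \<Rightarrow> grid_fun \<Rightarrow> grid_fun"
where
  "Phi d B \<psi>1 \<psi>2 u0 h k M' Z =
     (let M = cells M';
          x = (\<lambda>i. real i * h);
          V = node M Z
      in (\<lambda>n. (1 + 1 / h) * V n 0 - 1 / h * V n 1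
               - Qh h M' (\<lambda>i. B (x i) (Qh h M' (\<lambda>j. \<psi>2 (x j) * V n j)) * V n i),
          \<lambda>n i. if n = 0 then V 0 i - u0 (x i)
                else (V n i - V (n - 1) i) / k
                   + (V (n - 1) i - V (n - 1) (i - 1)) / h
                   + d (x i) (Qh h M' (\<lambda>j. \<psi>1 (x j) * V (n - 1) j)) * V (n - 1) i
                   - (V (n - 1) (i + 1) + V (n - 1) (i - 1) - 2 * V (n - 1) i) / h\<^sup>2,
          \<lambda>n. V n M / h))"

definition norm_sp :: "real \<Rightarrow> nat \<Rightarrow> (nat \<Rightarrow> real) \<Rightarrow> real" where
  "norm_sp h M V = sqrt (\<Sum>i = 1..M - 1. h * \<bar>V i\<bar>\<^sup>2)"

definition norm_star :: "real \<Rightarrow> nat \<Rightarrow> (nat \<Rightarrow> real) \<Rightarrow> real" where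
  "norm_star k N Z = sqrt (\<Sum>n = 0..N. k * \<bar>Z n\<bar>\<^sup>2)"

fun norm_X :: "real \<Rightarrow> real \<Rightarrow> nat \<Rightarrow> nat \<Rightarrow> grid_fun \<Rightarrow> real" where
  "norm_X h k M N (V0, V, VM) =
     h * (norm_star k N V0 + norm_star k N VM) + Max ((\<lambda>n. norm_sp h M (V n)) ` {0..N})"

fun norm_Y :: "real \<Rightarrow> real \<Rightarrow> nat \<Rightarrow> nat \<Rightarrow> grid_fun \<Rightarrow> real" where
  "norm_Y h k M N (P0, P, PM) =
     sqrt ((norm_star k N P0)\<^sup>2 + (norm_sp h M (P 0))\<^sup>2 + h * (norm_star k N PM)\<^sup>2
           + (\<Sum>n = 1..N. k * (norm_sp h M (P n))\<^sup>2))"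

definition ball_X :: "real \<Rightarrow> real \<Rightarrow> nat \<Rightarrow> nat \<Rightarrow> grid_fun \<Rightarrow> real \<Rightarrow> grid_fun set" where
  "ball_X h k M N Z \<rho> = {V. norm_X h k M N (V - Z) < \<rho>}"

definition nodal_values :: "real \<Rightarrow> (real \<Rightarrow> real \<Rightarrow> real) \<Rightarrow> real \<Rightarrow> real \<Rightarrow> grid_fun" where
  "nodal_values a u h k =
     (\<lambda>n. u 0 (real n * k), \<lambda>n i. u (real i * h) (real n * k), \<lambda>n. u a (real n * k))"

end

theory Submission
  imports Defs
begin

text \<open>
  The difference \<open>e\<close> of two grid functions is propagated by the operator
  \<open>e\<^sub>i \<mapsto> (1 - \<lambda> - 2r) e\<^sub>i + (\<lambda> + r) e\<^bsub>i-1\<^esub> + r e\<^bsub>i+1\<^esub>\<close>, a convex combination because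
  \<open>\<lambda> + 2r \<le> 1\<close>. By Jensen's inequality it increases the squared norm by at most boundary terms,
  and since \<open>\<lambda> = r h\<close> those at the left end are \<open>r h ((1 + h) e\<^sub>0\<^sup>2 - e\<^sub>1\<^sup>2)\<close>, exactly what the
  discrete Robin condition bounds by \<open>k\<close> times the square of its right-hand side. The nonlocal terms
  are Lipschitz on the ball, since \<open>d\<close> and \<open>B\<close> are continuously differentiable and the quadrature is
  bounded on the discrete \<open>L\<^sup>2\<close> space uniformly in \<open>h\<close>. A discrete Gronwall argument concludes.
\<close>

section \<open>The discrete L2 norm in space\<close>

lemma norm_sp_L2_set: "0 \<le> h \<Longrightarrow> norm_sp h M V = sqrt h * L2_set V {1..M - 1}"
  by (simp add: norm_sp_def L2_set_def sum_distrib_left[symmetric] real_sqrt_mult)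

lemma norm_sp_nonneg: "0 \<le> h \<Longrightarrow> 0 \<le> norm_sp h M V"
  by (simp add: norm_sp_L2_set)

lemma norm_sp_power2: "0 \<le> h \<Longrightarrow> (norm_sp h M V)\<^sup>2 = h * (\<Sum>i = 1..M - 1. (V i)\<^sup>2)"
  by (simp add: norm_sp_def sum_nonneg sum_distrib_left)

lemma norm_sp_cong:
  "(\<And>i. 1 \<le> i \<Longrightarrow> i \<le> M - 1 \<Longrightarrow> V i = W i) \<Longrightarrow> norm_sp h M V = norm_sp h M W"
  unfolding norm_sp_def by (auto intro!: sum.cong arg_cong[of _ _ sqrt])

lemma norm_sp_mono:
  assumes "0 \<le> h" and "\<And>i. 1 \<le> i \<Longrightarrow> i \<le> M - 1 \<Longrightarrow> \<bar>V i\<bar> \<le> \<bar>W i\<bar>"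
  shows "norm_sp h M V \<le> norm_sp h M W"
  unfolding norm_sp_def using assms
  by (intro real_sqrt_le_mono sum_mono mult_left_mono power_mono) auto

lemma norm_sp_add:
  assumes "0 \<le> h"
  shows "norm_sp h M (\<lambda>i. V i + W i) \<le> norm_sp h M V + norm_sp h M W"
proof -
  have "sqrt h * L2_set (\<lambda>i. V i + W i) {1..M - 1}
      \<le> sqrt h * (L2_set V {1..M - 1} + L2_set W {1..M - 1})"
    using assms by (intro mult_left_mono L2_set_triangle_ineq) auto
  then show ?thesis using assms by (simp add: norm_sp_L2_set distrib_left)
qed

text \<open>The modulus matches the pointwise majorants such as
  \<open>K * \<bar>V i - W i\<bar>\<close> to which the rule is applied.\<close>

lemma norm_sp_cmult:
  assumes "0 \<le> h" and "0 \<le> c"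
  shows "norm_sp h M (\<lambda>i. c * \<bar>V i\<bar>) = c * norm_sp h M V"
proof -
  have "(\<Sum>i = 1..M - 1. h * \<bar>c * \<bar>V i\<bar>\<bar>\<^sup>2) = c\<^sup>2 * (\<Sum>i = 1..M - 1. h * \<bar>V i\<bar>\<^sup>2)"
    by (simp add: sum_distrib_left power_mult_distrib mult_ac)
  then show ?thesis using assms by (simp add: norm_sp_def real_sqrt_mult)
qed

lemma norm_sp_bound:
  assumes "0 \<le> h" and "real M * h \<le> a" and "0 \<le> c"
    and "\<And>i. 1 \<le> i \<Longrightarrow> i \<le> M - 1 \<Longrightarrow> \<bar>V i\<bar> \<le> c"
  shows "norm_sp h M V \<le> sqrt a * c"
proof -
  have "norm_sp h M V \<le> norm_sp h M (\<lambda>i. c)"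
    using assms by (intro norm_sp_mono) auto
  also have "\<dots> = sqrt (real (M - 1) * h) * c"
    using assms by (simp add: norm_sp_def real_sqrt_mult)
  also have "\<dots> \<le> sqrt a * c"
  proof -
    have "real (M - 1) * h \<le> real M * h" using assms by (intro mult_right_mono) auto
    then show ?thesis using assms by (intro mult_right_mono real_sqrt_le_mono) auto
  qed
  finally show ?thesis .
qed

lemma sum_abs_le_norm_sp:
  assumes "0 \<le> h" and "real M * h \<le> a"
  shows "h * (\<Sum>i = 1..M - 1. \<bar>V i\<bar>) \<le> sqrt a * norm_sp h M V"
proof -
  \<comment> \<open>Cauchy-Schwarz against the constant 1, whose discrete norm is at most
    \<open>sqrt a\<close>.\<close>
  have "(\<Sum>i = 1..M - 1. \<bar>V i\<bar> * \<bar>1\<bar>) \<le> L2_set V {1..M - 1} * L2_set (\<lambda>_. 1) {1..M - 1}"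
    by (rule L2_set_mult_ineq)
  also have "\<dots> = L2_set V {1..M - 1} * sqrt (real (M - 1))"
    by (simp add: L2_set_def)
  finally have "h * (\<Sum>i = 1..M - 1. \<bar>V i\<bar>)
      \<le> h * (L2_set V {1..M - 1} * sqrt (real (M - 1)))"
    using assms by (intro mult_left_mono) auto
  also have "\<dots> = sqrt (real (M - 1) * h) * norm_sp h M V"
    using assms by (simp add: norm_sp_L2_set real_sqrt_mult)
  also have "\<dots> \<le> sqrt a * norm_sp h M V"
  proof -
    have "real (M - 1) * h \<le> real M * h" using assms by (intro mult_right_mono) auto
    then show ?thesis
      using assms by (intro mult_right_mono real_sqrt_le_mono norm_sp_nonneg) auto
  qed
  finally show ?thesis .
qed

section \<open>Quadrature and Lipschitz bounds for the nonlocal terms\<close>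

lemma grid_point_mem:
  assumes "0 \<le> h" and "real M * h \<le> a" and "i \<le> M"
  shows "real i * h \<in> {0..a}"
  using assms mult_right_mono[of "real i" "real M" h] by auto

lemma Qh_diff: "Qh h M' V - Qh h M' W = Qh h M' (\<lambda>i. V i - W i)"
  unfolding Qh_def
  by (simp add: sum_subtractf sum.distrib sum_distrib_left[symmetric] algebra_simps)

text \<open>Crude count per block: with \<open>S\<close> the sum of the moduli, each end block gives
  \<open>8/3 * h * S\<close> and the middle one \<open>2 * h * S\<close>; the total factor 22/3 is
  rounded up to 8. What matters is independence of \<open>h\<close> and \<open>M'\<close>.\<close>

lemma abs_Qh_le_sum:
  assumes "0 \<le> h"
  shows "\<bar>Qh h M' V\<bar> \<le> 8 * h * (\<Sum>i = 1..cells M' - 1. \<bar>V i\<bar>)"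
proof -
  define S where "S = (\<Sum>i = 1..cells M' - 1. \<bar>V i\<bar>)"
  \<comment> \<open>An injective \<open>g\<close> meets each node at most once, so weighted sums can
    be estimated one index family at a time.\<close>
  have part: "(\<Sum>i\<in>A. \<bar>V (g i)\<bar>) \<le> S"
    if "inj_on g A" "g ` A \<subseteq> {1..cells M' - 1}" for A :: "nat set" and g
    unfolding S_def using that
    by (subst sum.reindex[OF that(1), of "\<lambda>i. \<bar>V i\<bar>", unfolded o_def, symmetric])
      (intro sum_mono2, auto)
  have three: "\<bar>V p\<bar> + \<bar>V (p + 1)\<bar> + \<bar>V (p + 2)\<bar> \<le> S"
    if "1 \<le> p" "p + 2 \<le> cells M' - 1" for p
  proof -
    have "(\<Sum>i\<in>{p, p + 1, p + 2}. \<bar>V (id i)\<bar>) \<le> S"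
      using that by (intro part) auto
    then show ?thesis by simp
  qed
  have l: "\<bar>2 * V 1 - V 2 + 2 * V 3\<bar> \<le> 2 * S"
    using three[of 1] by (simp add: cells_def numeral_eq_Suc)
  have u: "\<bar>2 * V (2*M' + 3) - V (2*M' + 4) + 2 * V (2*M' + 5)\<bar> \<le> 2 * S"
    using three[of "2*M' + 3"] by (simp add: cells_def numeral_eq_Suc)
  have "\<bar>\<Sum>i = 2..M'. V (2*i) + 4 * V (2*i + 1) + V (2*i + 2)\<bar>
      \<le> (\<Sum>i = 2..M'. \<bar>V (2*i)\<bar> + 4 * \<bar>V (2*i + 1)\<bar> + \<bar>V (2*i + 2)\<bar>)"
    by (rule order_trans[OF sum_abs], rule sum_mono) linarith
  also have "\<dots> = (\<Sum>i = 2..M'. \<bar>V (2*i)\<bar>) + 4 * (\<Sum>i = 2..M'. \<bar>V (2*i + 1)\<bar>)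
      + (\<Sum>i = 2..M'. \<bar>V (2*i + 2)\<bar>)"
    by (simp add: sum.distrib sum_distrib_left)
  \<comment> \<open>The three families are treated separately because \<open>2*i + 2\<close> for one
    \<open>i\<close> is \<open>2*i\<close> for the next.\<close>
  also have "\<dots> \<le> S + 4 * S + S"
    by (intro add_mono mult_left_mono part) (auto simp: inj_on_def cells_def)
  finally have m: "\<bar>\<Sum>i = 2..M'. V (2*i) + 4 * V (2*i + 1) + V (2*i + 2)\<bar> \<le> 6 * S"
    by simp
  have "0 \<le> S" unfolding S_def by (simp add: sum_nonneg)
  have "\<bar>Qh h M' V\<bar> \<le> \<bar>4 * h / 3 * (2 * V 1 - V 2 + 2 * V 3)\<bar>
      + \<bar>h / 3 * (\<Sum>i = 2..M'. V (2*i) + 4 * V (2*i + 1) + V (2*i + 2))\<bar>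
      + \<bar>4 * h / 3 * (2 * V (2*M' + 3) - V (2*M' + 4) + 2 * V (2*M' + 5))\<bar>"
    unfolding Qh_def by linarith
  also have "\<dots> \<le> 4 * h / 3 * (2 * S) + h / 3 * (6 * S) + 4 * h / 3 * (2 * S)"
    unfolding abs_mult using assms l u m by (intro add_mono mult_mono) auto
  also have "\<dots> \<le> 8 * h * S"
    using assms \<open>0 \<le> S\<close> by simp
  finally show ?thesis unfolding S_def .
qed

text \<open>The mesh enters only through \<open>cells M' * h \<le> a\<close>; this is the uniformity
  in \<open>h\<close> of the quadrature bound.\<close>

lemma abs_Qh_le_norm_sp:
  assumes "0 \<le> h" and "real (cells M') * h \<le> a"
  shows "\<bar>Qh h M' V\<bar> \<le> 8 * sqrt a * norm_sp h (cells M') V"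
  using abs_Qh_le_sum[OF assms(1), of M' V] sum_abs_le_norm_sp[OF assms, of V] by linarith

lemma abs_Qh_weighted_le:
  assumes "0 \<le> h" and "real (cells M') * h \<le> a" and "0 \<le> c"
    and "\<And>x. x \<in> {0..a} \<Longrightarrow> \<bar>\<psi> x\<bar> \<le> c"
  shows "\<bar>Qh h M' (\<lambda>j. \<psi> (real j * h) * V j)\<bar> \<le> 8 * sqrt a * c * norm_sp h (cells M') V"
proof -
  have "real j * h \<in> {0..a}" if "j \<le> cells M' - 1" for j
    using that by (intro grid_point_mem[OF assms(1,2)]) simp
  then have "norm_sp h (cells M') (\<lambda>j. \<psi> (real j * h) * V j)
      \<le> norm_sp h (cells M') (\<lambda>j. c * \<bar>V j\<bar>)"
    using assms by (intro norm_sp_mono) (auto simp: abs_mult intro!: mult_right_mono)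
  also have "\<dots> = c * norm_sp h (cells M') V"
    using assms by (intro norm_sp_cmult)
  finally have "8 * sqrt a * norm_sp h (cells M') (\<lambda>j. \<psi> (real j * h) * V j)
      \<le> 8 * sqrt a * (c * norm_sp h (cells M') V)"
    using assms by (intro mult_left_mono) (auto intro: order_trans[OF _ assms(2)])
  then show ?thesis
    using abs_Qh_le_norm_sp[OF assms(1,2), of "\<lambda>j. \<psi> (real j * h) * V j"] by simp
qed

text \<open>The difference of products is split into \<open>f (q V) * (V - W)\<close> and
  \<open>(f (q V) - f (q W)) * W\<close>; the second part costs the Lipschitz constant of
  \<open>q\<close> times the norm of \<open>W\<close>. Control of \<open>f\<close> is asked only for
  \<open>\<bar>s\<bar> \<le> 8 * sqrt a * c * \<rho>\<close>, which contains the values of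
  \<open>q\<close> on grid functions of norm at most \<open>\<rho>\<close>.\<close>

lemma nonlocal_lipschitz:
  fixes f :: "real \<Rightarrow> real \<Rightarrow> real"
  assumes h: "0 \<le> h" "real (cells M') * h \<le> a" and c: "0 \<le> c"
    and \<psi>: "\<And>x. x \<in> {0..a} \<Longrightarrow> \<bar>\<psi> x\<bar> \<le> c"
    and V: "norm_sp h (cells M') V \<le> \<rho>" and W: "norm_sp h (cells M') W \<le> \<rho>"
    and f: "\<And>x s. x \<in> {0..a} \<Longrightarrow> \<bar>s\<bar> \<le> 8 * sqrt a * c * \<rho> \<Longrightarrow> \<bar>f x s\<bar> \<le> K"
    and f_lip: "\<And>x s s'. x \<in> {0..a} \<Longrightarrow> \<bar>s\<bar> \<le> 8 * sqrt a * c * \<rho> \<Longrightarrow> \<bar>s'\<bar> \<le> 8 * sqrt a * c * \<rho>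
      \<Longrightarrow> \<bar>f x s - f x s'\<bar> \<le> K * \<bar>s - s'\<bar>"
    and "0 \<le> K"
  defines "q Z \<equiv> Qh h M' (\<lambda>j. \<psi> (real j * h) * Z j)"
  shows "norm_sp h (cells M') (\<lambda>i. f (real i * h) (q V) * V i - f (real i * h) (q W) * W i)
    \<le> K * (1 + 8 * sqrt a * c * \<rho>) * norm_sp h (cells M') (\<lambda>i. V i - W i)"
proof -
  define M where "M = cells M'"
  define E where "E = norm_sp h M (\<lambda>i. V i - W i)"
  \<comment> \<open>\<open>g\<close> bounds the linear functional \<open>q\<close>: it gives the
    range of \<open>q\<close> and, through \<open>Qh_diff\<close>, its Lipschitz constant.\<close>
  define g where "g = 8 * sqrt a * c"
  have "0 \<le> a" using h by (auto intro: order_trans[OF _ h(2)])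
  then have g: "0 \<le> g" using c by (simp add: g_def)
  have E: "0 \<le> E" using h by (simp add: E_def norm_sp_nonneg)
  have x: "real j * h \<in> {0..a}" if "j \<le> M - 1" for j
    using that by (intro grid_point_mem[OF h]) (simp add: M_def)
  have q: "\<bar>q Z\<bar> \<le> g * \<rho>" if "norm_sp h M Z \<le> \<rho>" for Z
    using abs_Qh_weighted_le[where \<psi> = \<psi> and V = Z, OF h c \<psi>] mult_left_mono[OF that g]
    by (simp add: q_def g_def M_def)
  have qd: "\<bar>q V - q W\<bar> \<le> g * E"
    using abs_Qh_weighted_le[where \<psi> = \<psi> and V = "\<lambda>i. V i - W i", OF h c \<psi>]
    by (simp add: q_def g_def E_def M_def Qh_diff algebra_simps)
  have "norm_sp h M (\<lambda>i. f (real i * h) (q V) * V i - f (real i * h) (q W) * W i)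
     \<le> norm_sp h M (\<lambda>i. K * \<bar>V i - W i\<bar> + (K * (g * E)) * \<bar>W i\<bar>)"
  proof (rule norm_sp_mono[OF h(1)])
    fix i assume i: "1 \<le> i" "i \<le> M - 1"
    let ?x = "real i * h"
    have "\<bar>f ?x (q V) * V i - f ?x (q W) * W i\<bar>
      = \<bar>f ?x (q V) * (V i - W i) + (f ?x (q V) - f ?x (q W)) * W i\<bar>"
      by (simp add: algebra_simps)
    also have "\<dots> \<le> \<bar>f ?x (q V)\<bar> * \<bar>V i - W i\<bar> + \<bar>f ?x (q V) - f ?x (q W)\<bar> * \<bar>W i\<bar>"
      by (metis abs_mult abs_triangle_ineq)
    also have "\<dots> \<le> K * \<bar>V i - W i\<bar> + (K * (g * E)) * \<bar>W i\<bar>"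
    proof (intro add_mono mult_right_mono)
      show "\<bar>f ?x (q V)\<bar> \<le> K"
        using f[OF x[OF i(2)]] q[of V] V by (simp add: g_def M_def)
      have "\<bar>f ?x (q V) - f ?x (q W)\<bar> \<le> K * \<bar>q V - q W\<bar>"
        using f_lip[OF x[OF i(2)]] q[of V] q[of W] V W by (simp add: g_def M_def)
      also have "\<dots> \<le> K * (g * E)" using qd \<open>0 \<le> K\<close> by (rule mult_left_mono)
      finally show "\<bar>f ?x (q V) - f ?x (q W)\<bar> \<le> K * (g * E)" .
    qed auto
    finally show "\<bar>f ?x (q V) * V i - f ?x (q W) * W i\<bar>
      \<le> \<bar>K * \<bar>V i - W i\<bar> + (K * (g * E)) * \<bar>W i\<bar>\<bar>" by linarith
  qed
  also have "\<dots> \<le> norm_sp h M (\<lambda>i. K * \<bar>V i - W i\<bar>) + norm_sp h M (\<lambda>i. (K * (g * E)) * \<bar>W i\<bar>)"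
    using h by (intro norm_sp_add)
  also have "\<dots> = K * E + (K * (g * E)) * norm_sp h M W"
    using h \<open>0 \<le> K\<close> g E unfolding E_def by (subst (1 2) norm_sp_cmult) auto
  also have "\<dots> \<le> K * E + (K * (g * E)) * \<rho>"
    using W g E \<open>0 \<le> K\<close> by (intro add_left_mono mult_left_mono) (auto simp: M_def)
  finally show ?thesis by (simp add: E_def M_def g_def algebra_simps)
qed

section \<open>Bounds from smoothness on compact sets\<close>

lemma cont_diff1_bounded:
  assumes "cont_diff1 {a..b} f"
  obtains c :: real where "0 \<le> c" and "\<And>x. x \<in> {a..b} \<Longrightarrow> \<bar>f x\<bar> \<le> c"
proof -
  have "continuous_on {a..b} f"
    using assms unfolding cont_diff1_def
    by (auto simp: continuous_on_eq_continuous_within intro: DERIV_continuous)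
  then have "bounded (f ` {a..b})"
    by (intro compact_imp_bounded compact_continuous_image) auto
  then obtain c where "0 < c" "\<And>x. x \<in> {a..b} \<Longrightarrow> \<bar>f x\<bar> \<le> c"
    unfolding bounded_pos by auto
  then show ?thesis using that[of c] by simp
qed

lemma partials_upto_bounded:
  assumes "partials_upto m X Y f D" and "i + j \<le> m"
    and "compact X'" "X' \<subseteq> X" and "compact Y'" "Y' \<subseteq> Y"
  obtains c :: real where "0 < c" and "\<And>x y. x \<in> X' \<Longrightarrow> y \<in> Y' \<Longrightarrow> \<bar>D i j x y\<bar> \<le> c"
proof -
  have "continuous_on (X \<times> Y) (\<lambda>(x, y). D i j x y)"
    using assms(1,2) by (simp add: partials_upto_def)
  then have "continuous_on (X' \<times> Y') (\<lambda>(x, y). D i j x y)"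
    by (rule continuous_on_subset) (use assms in auto)
  then have "bounded ((\<lambda>(x, y). D i j x y) ` (X' \<times> Y'))"
    using assms by (intro compact_imp_bounded compact_continuous_image compact_Times)
  then obtain c where "0 < c" "\<And>p. p \<in> X' \<times> Y' \<Longrightarrow> \<bar>(\<lambda>(x, y). D i j x y) p\<bar> \<le> c"
    unfolding bounded_pos by force
  then show ?thesis using that[of c] by fastforce
qed

text \<open>Compactness bounds \<open>f\<close> and its derivative in \<open>s\<close>, and the mean
  value inequality turns the latter bound into a Lipschitz constant. The range of \<open>s\<close>
  is symmetric because quadratures of arbitrary grid functions can have either sign.\<close>

lemma cont_diff2_locally_lipschitz:
  assumes "cont_diff2 1 {0..a} UNIV f"
  obtains K where "0 \<le> K"
    and "\<And>x s. x \<in> {0..a} \<Longrightarrow> \<bar>s\<bar> \<le> \<rho> \<Longrightarrow> \<bar>f x s\<bar> \<le> K"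
    and "\<And>x s s'. x \<in> {0..a} \<Longrightarrow> \<bar>s\<bar> \<le> \<rho> \<Longrightarrow> \<bar>s'\<bar> \<le> \<rho> \<Longrightarrow> \<bar>f x s - f x s'\<bar> \<le> K * \<bar>s - s'\<bar>"
proof -
  obtain D where D: "partials_upto 1 {0..a} UNIV f D"
    using assms unfolding cont_diff2_def by blast
  obtain c0 where c0: "0 < c0"
      "\<And>x y. x \<in> {0..a} \<Longrightarrow> y \<in> {-\<rho>..\<rho>} \<Longrightarrow> \<bar>D 0 0 x y\<bar> \<le> c0"
    by (rule partials_upto_bounded[OF D, of 0 0 "{0..a}" "{-\<rho>..\<rho>}"]) auto
  obtain c1 where c1: "0 < c1"
      "\<And>x y. x \<in> {0..a} \<Longrightarrow> y \<in> {-\<rho>..\<rho>} \<Longrightarrow> \<bar>D 0 1 x y\<bar> \<le> c1"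
    by (rule partials_upto_bounded[OF D, of 0 1 "{0..a}" "{-\<rho>..\<rho>}"]) auto
  have D0: "D 0 0 x s = f x s" if "x \<in> {0..a}" for x s
    using D that by (simp add: partials_upto_def)
  have deriv: "(f x has_real_derivative D 0 1 x s) (at s within {-\<rho>..\<rho>})"
    if "x \<in> {0..a}" for x s
  proof -
    have "(D 0 0 x has_real_derivative D 0 (Suc 0) x s) (at s)"
      using D that unfolding partials_upto_def by auto
    moreover have "D 0 0 x = f x" using D0[OF that] by auto
    ultimately show ?thesis
      by (metis One_nat_def has_field_derivative_at_within)
  qed
  show ?thesis
  proof (rule that[of "max c0 c1"])
    show "0 \<le> max c0 c1" using c0 by simp
  next
    fix x s assume "x \<in> {0..a}" "\<bar>s\<bar> \<le> \<rho>"
    then have "\<bar>f x s\<bar> \<le> c0" using c0(2)[of x s] D0 by (auto simp: abs_le_iff)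
    then show "\<bar>f x s\<bar> \<le> max c0 c1" by simp
  next
    fix x s s' assume x: "x \<in> {0..a}" and s: "\<bar>s\<bar> \<le> \<rho>" "\<bar>s'\<bar> \<le> \<rho>"
    have "norm (f x s - f x s') \<le> c1 * norm (s - s')"
      by (rule field_differentiable_bound[where S = "{-\<rho>..\<rho>}" and f' = "D 0 1 x"])
        (use deriv[OF x] c1(2)[OF x] s in \<open>auto simp: abs_le_iff\<close>)
    also have "\<dots> \<le> max c0 c1 * norm (s - s')" by (intro mult_right_mono) auto
    finally show "\<bar>f x s - f x s'\<bar> \<le> max c0 c1 * \<bar>s - s'\<bar>" by simp
  qed
qed

section \<open>Energy estimate for one time step\<close>

lemma norm_star_power2: "0 \<le> k \<Longrightarrow> (norm_star k N Z)\<^sup>2 = (\<Sum>n = 0..N. k * (Z n)\<^sup>2)"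
  by (simp add: norm_star_def sum_nonneg)

text \<open>Jensen's inequality for the square, proved through its exact gap, the weighted sum of
  squared pairwise differences.\<close>

lemma power2_convex3:
  fixes x y z :: real
  assumes "0 \<le> \<alpha>" "0 \<le> \<beta>" "0 \<le> \<gamma>" "\<alpha> + \<beta> + \<gamma> = 1"
  shows "(\<alpha> * x + \<beta> * y + \<gamma> * z)\<^sup>2 \<le> \<alpha> * x\<^sup>2 + \<beta> * y\<^sup>2 + \<gamma> * z\<^sup>2"
proof -
  have \<alpha>: "\<alpha> = 1 - \<beta> - \<gamma>" using assms by simp
  have "\<alpha> * x\<^sup>2 + \<beta> * y\<^sup>2 + \<gamma> * z\<^sup>2 - (\<alpha> * x + \<beta> * y + \<gamma> * z)\<^sup>2
    = \<alpha> * \<beta> * (x - y)\<^sup>2 + \<alpha> * \<gamma> * (x - z)\<^sup>2 + \<beta> * \<gamma> * (y - z)\<^sup>2"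
    unfolding \<alpha> by algebra
  also have "\<dots> \<ge> 0" using assms by simp
  finally show ?thesis by simp
qed

lemma sum_shift_down:
  fixes f :: "nat \<Rightarrow> 'a::ab_group_add"
  shows "(\<Sum>i = 1..m. f (i - 1)) = (\<Sum>i = 1..m. f i) + f 0 - f m"
  by (induction m) auto

lemma sum_shift_up:
  fixes f :: "nat \<Rightarrow> 'a::ab_group_add"
  shows "(\<Sum>i = 1..m. f (i + 1)) = (\<Sum>i = 1..m. f i) + f (m + 1) - f 1"
  by (induction m) auto

text \<open>After Jensen at every interior node, index shifts recombine the weights to 1 and leave
  only boundary terms. The negative term in \<open>e 1\<close> is kept because the Robin condition
  consumes it.\<close>

lemma convection_diffusion_energy:
  fixes e :: "nat \<Rightarrow> real"
  assumes "0 \<le> lam" "0 \<le> r" "lam + 2 * r \<le> 1" "1 \<le> M"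
  shows "(\<Sum>i = 1..M - 1. ((1 - lam - 2 * r) * e i + (lam + r) * e (i - 1) + r * e (i + 1))\<^sup>2)
    \<le> (\<Sum>i = 1..M - 1. (e i)\<^sup>2) + (lam + r) * (e 0)\<^sup>2 - r * (e 1)\<^sup>2 + r * (e M)\<^sup>2"
proof -
  have "(\<Sum>i = 1..M - 1. ((1 - lam - 2 * r) * e i + (lam + r) * e (i - 1) + r * e (i + 1))\<^sup>2)
    \<le> (\<Sum>i = 1..M - 1. (1 - lam - 2 * r) * (e i)\<^sup>2 + (lam + r) * (e (i - 1))\<^sup>2 + r * (e (i + 1))\<^sup>2)"
    using assms by (intro sum_mono power2_convex3) auto
  also have "\<dots> = (1 - lam - 2 * r) * (\<Sum>i = 1..M - 1. (e i)\<^sup>2)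
      + (lam + r) * (\<Sum>i = 1..M - 1. (e (i - 1))\<^sup>2) + r * (\<Sum>i = 1..M - 1. (e (i + 1))\<^sup>2)"
    by (simp add: sum.distrib sum_distrib_left)
  also have "\<dots> = (\<Sum>i = 1..M - 1. (e i)\<^sup>2) + (lam + r) * (e 0)\<^sup>2 - (lam + r) * (e (M - 1))\<^sup>2
      - r * (e 1)\<^sup>2 + r * (e M)\<^sup>2"
    unfolding sum_shift_down[of "\<lambda>i. (e i)\<^sup>2"] sum_shift_up[of "\<lambda>i. (e i)\<^sup>2"]
    using assms(4) by (simp add: algebra_simps)
  \<comment> \<open>The discarded term at node \<open>M - 1\<close> has the favourable sign.\<close>
  also have "\<dots> \<le> (\<Sum>i = 1..M - 1. (e i)\<^sup>2) + (lam + r) * (e 0)\<^sup>2 - r * (e 1)\<^sup>2 + r * (e M)\<^sup>2"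
    using assms by simp
  finally show ?thesis .
qed

text \<open>The Robin condition gives \<open>e\<^sub>0 = (e\<^sub>1 + h (b + p)) / (1 + h)\<close>, a convex combination.\<close>

lemma boundary_power2:
  fixes e0 e1 b p h :: real
  assumes "0 < h" and "(1 + 1 / h) * e0 - 1 / h * e1 - b = p"
  shows "(1 + h) * e0\<^sup>2 \<le> e1\<^sup>2 + h * (b + p)\<^sup>2"
proof -
  have "h * p = (1 + h) * e0 - e1 - h * b"
    using assms(1) unfolding assms(2)[symmetric] by (simp add: field_simps)
  then have "(1 + h) * e0 = e1 + h * (b + p)"
    by (simp add: algebra_simps)
  then have "((1 + h) * e0)\<^sup>2 = (e1 + h * (b + p))\<^sup>2" by simp
  \<comment> \<open>Convexity of the square with weights \<open>1 / (1 + h)\<close> and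
    \<open>h / (1 + h)\<close>, cleared of denominators and with its exact gap.\<close>
  also have "\<dots> = (1 + h) * (e1\<^sup>2 + h * (b + p)\<^sup>2) - h * (e1 - (b + p))\<^sup>2" by algebra
  also have "\<dots> \<le> (1 + h) * (e1\<^sup>2 + h * (b + p)\<^sup>2)" using assms by simp
  finally have "(1 + h) * ((1 + h) * e0\<^sup>2) \<le> (1 + h) * (e1\<^sup>2 + h * (b + p)\<^sup>2)"
    by (simp add: power2_eq_square algebra_simps)
  then show ?thesis using assms by (simp only: mult_le_cancel_left_pos)
qed

lemma power2_sum_le: "(x + y)\<^sup>2 \<le> 2 * x\<^sup>2 + 2 * y\<^sup>2" for x y :: real
  using sum_squares_bound[of x y] by (simp add: power2_sum)

text \<open>Young's inequality for the cross term \<open>2 * k * x * y\<close>, weighted so that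
  \<open>x\<^sup>2\<close> gains only the factor \<open>1 + k\<close>, whose powers over
  \<open>T / k\<close> steps stay bounded.\<close>

lemma power2_add_scaled_le:
  fixes k x y :: real
  assumes "0 \<le> k"
  shows "(x + k * y)\<^sup>2 \<le> (1 + k) * x\<^sup>2 + k * (1 + k) * y\<^sup>2"
proof -
  have "(1 + k) * x\<^sup>2 + k * (1 + k) * y\<^sup>2 - (x + k * y)\<^sup>2 = k * (x - y)\<^sup>2" by algebra
  then show ?thesis using assms by (smt (verit) zero_le_mult_iff zero_le_power2)
qed

text \<open>By induction; each new source is inflated by a power of \<open>1 + c\<close>, which is
  at least 1, so that a common factor comes out. The source \<open>q j\<close> belongs to the step
  from \<open>j - 1\<close> to \<open>j\<close>.\<close>

lemma discrete_gronwall: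
  fixes c :: real
  assumes "0 \<le> c" and "\<And>n. n < N \<Longrightarrow> g (Suc n) \<le> (1 + c) * g n + q (Suc n)"
    and "\<And>n. 0 \<le> q n" and "n \<le> N"
  shows "g n \<le> (1 + c) ^ n * (g 0 + (\<Sum>j = 1..n. q j))"
  using \<open>n \<le> N\<close>
proof (induction n)
  case (Suc n)
  have "g (Suc n) \<le> (1 + c) * g n + q (Suc n)" using Suc.prems assms(2) by simp
  also have "\<dots> \<le> (1 + c) * ((1 + c) ^ n * (g 0 + (\<Sum>j = 1..n. q j))) + (1 + c) ^ Suc n * q (Suc n)"
  proof (intro add_mono mult_left_mono)
    show "q (Suc n) \<le> (1 + c) ^ Suc n * q (Suc n)"
      using assms(1,3) one_le_power[of "1 + c" "Suc n"] mult_right_mono[of 1 _ "q (Suc n)"] by simp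
  qed (use Suc assms(1) in auto)
  finally show ?case by (simp add: algebra_simps)
qed simp

text \<open>\<open>e\<close> and \<open>e'\<close> are the differences at consecutive time levels.
  \<open>b0\<close> and \<open>D\<close> stand for the differences of the nonlocal boundary and
  reaction terms, known only through their size relative to \<open>e\<close>; \<open>p0\<close>,
  \<open>pM\<close> and \<open>P\<close> are residuals.\<close>

lemma scheme_step:
  fixes e e' D P :: "nat \<Rightarrow> real" and b0 p0 pM :: real
  assumes h: "0 < h" and k: "0 < k" "k \<le> T" "k = r * h\<^sup>2" "k = lam * h" "lam + 2 * r \<le> 1"
    and M: "1 \<le> M" and K: "0 \<le> K"
    and left: "(1 + 1 / h) * e 0 - 1 / h * e 1 - b0 = p0"
    and right: "e M / h = pM"
    and inner: "\<And>i. 1 \<le> i \<Longrightarrow> i \<le> M - 1 \<Longrightarrow>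
      (e' i - e i) / k + (e i - e (i - 1)) / h + D i - (e (i + 1) + e (i - 1) - 2 * e i) / h\<^sup>2 = P i"
    and b0: "\<bar>b0\<bar> \<le> K * norm_sp h M e" and D: "norm_sp h M D \<le> K * norm_sp h M e"
  shows "(norm_sp h M e')\<^sup>2 \<le> (1 + (1 + 4 * K\<^sup>2 * (1 + T)) * k) * (norm_sp h M e)\<^sup>2
    + 2 * (1 + T) * k * (p0\<^sup>2 + h * pM\<^sup>2 + (norm_sp h M P)\<^sup>2)"
proof -
  define G where "G = (norm_sp h M e)\<^sup>2"
  \<comment> \<open>The scheme reads \<open>e' = A + k * y\<close>, with \<open>A\<close> the convex
    combination and \<open>y\<close> the residual minus the reaction term.\<close>
  define A where "A i = (1 - lam - 2 * r) * e i + (lam + r) * e (i - 1) + r * e (i + 1)" for i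
  define y where "y i = P i - D i" for i
  \<comment> \<open>From the two expressions for \<open>k\<close>. It turns
    \<open>(lam + r) * (e 0)\<^sup>2\<close> into \<open>r * (1 + h) * (e 0)\<^sup>2\<close>, the
    form that \<open>boundary_power2\<close> controls.\<close>
  have lam: "lam = r * h" using k h by (simp add: power2_eq_square)
  have r: "0 < r" using k h by (simp add: zero_less_mult_iff)
  have lam0: "0 < lam" using lam r h by simp
  have e': "e' i = A i + k * y i" if "1 \<le> i" "i \<le> M - 1" for i
  proof -
    have "k / h = lam" using k h by (simp add: field_simps)
    moreover have "k / h\<^sup>2 = r" using k h by (simp add: field_simps)
    moreover have "k * (X / k + Y / h + Z - W / h\<^sup>2) = X + k / h * Y + k * Z - k / h\<^sup>2 * W" for X Y Z W
      using k(1) h by (simp add: field_simps)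
    then have "e' i = e i - k / h * (e i - e (i - 1)) - k * D i
        + k / h\<^sup>2 * (e (i + 1) + e (i - 1) - 2 * e i) + k * P i"
      by (simp add: inner[OF that, symmetric])
    ultimately show ?thesis by (simp add: A_def y_def algebra_simps)
  qed
  have b2: "b0\<^sup>2 \<le> K\<^sup>2 * G"
    using power_mono[OF b0, of 2] by (simp add: G_def power_mult_distrib)
  have D2: "(norm_sp h M D)\<^sup>2 \<le> K\<^sup>2 * G"
    using power_mono[OF D, of 2] h by (simp add: G_def power_mult_distrib norm_sp_nonneg)
  have A2: "h * (\<Sum>i = 1..M - 1. (A i)\<^sup>2) \<le> G + 2 * k * (K\<^sup>2 * G + p0\<^sup>2) + k * h * pM\<^sup>2"
  proof -
    have "h * (\<Sum>i = 1..M - 1. (A i)\<^sup>2) \<le> h * ((\<Sum>i = 1..M - 1. (e i)\<^sup>2) + (lam + r) * (e 0)\<^sup>2 - r * (e 1)\<^sup>2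
        + r * (e M)\<^sup>2)"
      unfolding A_def using h M r lam0 k
      by (intro mult_left_mono convection_diffusion_energy) auto
    \<comment> \<open>At the right end \<open>e M = h * pM\<close> yields
      \<open>k * h * pM\<^sup>2\<close>, exactly the weight of \<open>pM\<close> in
      \<open>norm_Y\<close>.\<close>
    also have "\<dots> = G + h * r * ((1 + h) * (e 0)\<^sup>2 - (e 1)\<^sup>2) + k * h * pM\<^sup>2"
    proof -
      have "e M = h * pM" using right h by (simp add: field_simps)
      moreover have "G = h * (\<Sum>i = 1..M - 1. (e i)\<^sup>2)" using h by (simp add: G_def norm_sp_power2)
      ultimately show ?thesis by (simp add: lam k(3) algebra_simps power2_eq_square)
    qed
    \<comment> \<open>The \<open>e 1\<close> terms cancel, and \<open>h * r * h = k\<close> makes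
      the left end contribute only a multiple of \<open>k\<close>.\<close>
    also have "\<dots> \<le> G + h * r * (h * (b0 + p0)\<^sup>2) + k * h * pM\<^sup>2"
      using boundary_power2[OF h left] h r k(1) by (intro add_mono mult_left_mono) auto
    also have "\<dots> = G + k * (b0 + p0)\<^sup>2 + k * h * pM\<^sup>2"
      by (simp add: k(3) power2_eq_square)
    also have "\<dots> \<le> G + k * (2 * (K\<^sup>2 * G + p0\<^sup>2)) + k * h * pM\<^sup>2"
      using power2_sum_le[of b0 p0] b2 k(1) h by (intro add_mono mult_left_mono) auto
    finally show ?thesis by (simp add: algebra_simps)
  qed
  have y2: "h * (\<Sum>i = 1..M - 1. (y i)\<^sup>2) \<le> 2 * (norm_sp h M P)\<^sup>2 + 2 * (K\<^sup>2 * G)"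
  proof -
    have "h * (\<Sum>i = 1..M - 1. (y i)\<^sup>2) \<le> h * (\<Sum>i = 1..M - 1. 2 * (P i)\<^sup>2 + 2 * (D i)\<^sup>2)"
      using h power2_sum_le[of "P i" "- D i" for i] by (intro mult_left_mono sum_mono) (auto simp: y_def)
    also have "\<dots> = 2 * (norm_sp h M P)\<^sup>2 + 2 * (norm_sp h M D)\<^sup>2"
      using h by (simp add: norm_sp_power2 sum.distrib sum_distrib_left algebra_simps)
    finally show ?thesis using D2 by simp
  qed
  have "(norm_sp h M e')\<^sup>2 = h * (\<Sum>i = 1..M - 1. (A i + k * y i)\<^sup>2)"
    using h by (simp add: norm_sp_power2 e')
  also have "\<dots> \<le> h * (\<Sum>i = 1..M - 1. (1 + k) * (A i)\<^sup>2 + k * (1 + k) * (y i)\<^sup>2)"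
    using h k(1) by (intro mult_left_mono sum_mono power2_add_scaled_le) auto
  also have "\<dots> = (1 + k) * (h * (\<Sum>i = 1..M - 1. (A i)\<^sup>2)) + k * (1 + k) * (h * (\<Sum>i = 1..M - 1. (y i)\<^sup>2))"
    by (simp add: sum.distrib sum_distrib_left algebra_simps)
  also have "\<dots> \<le> (1 + k) * (G + 2 * k * (K\<^sup>2 * G + p0\<^sup>2) + k * h * pM\<^sup>2)
      + k * (1 + k) * (2 * (norm_sp h M P)\<^sup>2 + 2 * (K\<^sup>2 * G))"
    using A2 y2 k(1) by (intro add_mono mult_left_mono) auto
  also have "\<dots> = G + k * G + (1 + k) * (k * (4 * K\<^sup>2 * G + 2 * p0\<^sup>2 + h * pM\<^sup>2 + 2 * (norm_sp h M P)\<^sup>2))"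
    by algebra
  \<comment> \<open>Uses \<open>k \<le> T\<close>; the \<open>pM\<close> term is doubled so that all
    residuals share the factor 2.\<close>
  also have "\<dots> \<le> G + k * G + (1 + T) * (k * (4 * K\<^sup>2 * G + 2 * p0\<^sup>2 + 2 * (h * pM\<^sup>2) + 2 * (norm_sp h M P)\<^sup>2))"
    using k(1,2) h by (intro add_left_mono mult_mono) (auto simp: G_def)
  also have "\<dots> = (1 + (1 + 4 * K\<^sup>2 * (1 + T)) * k) * G + 2 * (1 + T) * k * (p0\<^sup>2 + h * pM\<^sup>2 + (norm_sp h M P)\<^sup>2)"
    by algebra
  finally show ?thesis by (simp add: G_def)
qed

section \<open>Stability over the whole time interval\<close>

text \<open>The Gronwall factor: the exponential of \<open>T\<close> times the growth rate in
  \<open>scheme_step\<close>, times the coefficient of the residuals there.\<close>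

definition growth :: "real \<Rightarrow> real \<Rightarrow> real" where
  "growth K T = exp ((1 + 4 * K\<^sup>2 * (1 + T)) * T) * (2 * (1 + T))"

text \<open>The summands bound, in this order, the left boundary, right boundary and interior parts
  of \<open>norm_X\<close>.\<close>

definition stability_const :: "real \<Rightarrow> real \<Rightarrow> real" where
  "stability_const K T = sqrt (2 * T * (1 + 2 * K\<^sup>2) * growth K T + 2) + 1 + sqrt (growth K T)"

text \<open>Gronwall applied to \<open>scheme_step\<close> controls every interior time level; the
  two boundary rows then recover the boundary values, with \<open>h \<le> 1\<close> absorbing spare
  powers of \<open>h\<close>.\<close>

lemma scheme_stability:
  fixes e D P :: "nat \<Rightarrow> nat \<Rightarrow> real" and b P0 PM :: "nat \<Rightarrow> real"
  assumes h: "0 < h" "h \<le> 1" and k: "0 < k" "k = r * h\<^sup>2" "k = lam * h" "lam + 2 * r \<le> 1"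
    and T: "T = real N * k" "0 < T"
    and M: "2 \<le> M" and K: "0 \<le> K"
    and left: "\<And>n. n \<le> N \<Longrightarrow> (1 + 1 / h) * e n 0 - 1 / h * e n 1 - b n = P0 n"
    and right: "\<And>n. n \<le> N \<Longrightarrow> e n M / h = PM n"
    and init: "\<And>i. 1 \<le> i \<Longrightarrow> i \<le> M - 1 \<Longrightarrow> e 0 i = P 0 i"
    and inner: "\<And>n i. n < N \<Longrightarrow> 1 \<le> i \<Longrightarrow> i \<le> M - 1 \<Longrightarrow>
      (e (Suc n) i - e n i) / k + (e n i - e n (i - 1)) / h + D n i
        - (e n (i + 1) + e n (i - 1) - 2 * e n i) / h\<^sup>2 = P (Suc n) i"
    and b: "\<And>n. n \<le> N \<Longrightarrow> \<bar>b n\<bar> \<le> K * norm_sp h M (e n)"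
    and D: "\<And>n. n \<le> N \<Longrightarrow> norm_sp h M (D n) \<le> K * norm_sp h M (e n)"
  shows "norm_X h k M N (\<lambda>n. e n 0, e, \<lambda>n. e n M)
    \<le> stability_const K T * norm_Y h k M N (P0, P, PM)"
proof -
  define Y where "Y = norm_Y h k M N (P0, P, PM)"
  define G where "G n = (norm_sp h M (e n))\<^sup>2" for n
  define C where "C = 1 + 4 * K\<^sup>2 * (1 + T)"
  \<comment> \<open>The scheme is explicit: the step to level \<open>n\<close> sees the boundary
    residuals of level \<open>n - 1\<close>, while its interior residual is indexed by
    \<open>n\<close>. The Gronwall sum starts at \<open>n = 1\<close>.\<close>
  define q where "q n = 2 * (1 + T) * k
    * ((P0 (n - 1))\<^sup>2 + h * (PM (n - 1))\<^sup>2 + (norm_sp h M (P n))\<^sup>2)" for n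
  \<comment> \<open>\<open>T > 0\<close> rules out \<open>N = 0\<close>, whence
    \<open>k \<le> T\<close>.\<close>
  have N: "1 \<le> N" using T by (cases N) auto
  have kT: "k \<le> T" using T N k(1) mult_right_mono[of 1 "real N" k] by simp
  have "0 \<le> C" using T by (simp add: C_def)
  have Y2: "Y\<^sup>2 = (\<Sum>n = 0..N. k * (P0 n)\<^sup>2) + (norm_sp h M (P 0))\<^sup>2 + h * (\<Sum>n = 0..N. k * (PM n)\<^sup>2)
      + (\<Sum>n = 1..N. k * (norm_sp h M (P n))\<^sup>2)"
    using h k(1) by (simp add: Y_def norm_star_power2 sum_nonneg)
  have "0 \<le> Y" using h k(1) by (simp add: Y_def norm_star_power2 sum_nonneg)
  have pos: "0 \<le> (\<Sum>n = 0..N. k * (P0 n)\<^sup>2)" "0 \<le> h * (\<Sum>n = 0..N. k * (PM n)\<^sup>2)"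
    "0 \<le> (\<Sum>n = 1..N. k * (norm_sp h M (P n))\<^sup>2)"
    using h(1) k(1) by (auto intro!: sum_nonneg mult_nonneg_nonneg)
  have step: "G (Suc n) \<le> (1 + C * k) * G n + q (Suc n)" if "n < N" for n
    using scheme_step[where e = "e n" and e' = "e (Suc n)" and D = "D n" and P = "P (Suc n)"
        and ?b0.0 = "b n" and ?p0.0 = "P0 n" and pM = "PM n",
        OF h(1) k(1) kT k(2-4) _ K left right inner b D] that M
    by (simp add: G_def C_def q_def)
  have G: "G n \<le> growth K T * Y\<^sup>2" if n: "n \<le> N" for n
  proof -
    have "G n \<le> (1 + C * k) ^ n * (G 0 + (\<Sum>j = 1..n. q j))"
      by (rule discrete_gronwall[where g = G and q = q and c = "C * k", OF _ step _ n])
        (use \<open>0 \<le> C\<close> k(1) T(2) h(1) in \<open>auto simp: q_def intro!: mult_nonneg_nonneg add_nonneg_nonneg\<close>)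
    also have "\<dots> \<le> exp (C * T) * (2 * (1 + T) * Y\<^sup>2)"
    proof (rule mult_mono)
      have "(1 + C * k) ^ n \<le> exp (C * k) ^ n"
        using \<open>0 \<le> C\<close> k(1) by (intro power_mono exp_ge_add_one_self) auto
      also have "\<dots> = exp (C * (real n * k))" by (simp add: exp_of_nat_mult[symmetric] mult_ac)
      also have "\<dots> \<le> exp (C * T)"
        using n \<open>0 \<le> C\<close> k(1) T by (auto intro!: mult_left_mono mult_right_mono)
      finally show "(1 + C * k) ^ n \<le> exp (C * T)" .
      have "(\<Sum>j = 1..n. q j) \<le> (\<Sum>j = 1..N. q j)"
        using n T(2) k(1) h(1) by (intro sum_mono2) (auto simp: q_def)
      also have "\<dots> = 2 * (1 + T) * ((\<Sum>j = 1..N. k * (P0 (j - 1))\<^sup>2) + h * (\<Sum>j = 1..N. k * (PM (j - 1))\<^sup>2)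
          + (\<Sum>j = 1..N. k * (norm_sp h M (P j))\<^sup>2))"
        by (simp add: q_def sum.distrib sum_distrib_left algebra_simps)
      also have "\<dots> \<le> 2 * (1 + T) * ((\<Sum>n = 0..N. k * (P0 n)\<^sup>2) + h * (\<Sum>n = 0..N. k * (PM n)\<^sup>2)
          + (\<Sum>j = 1..N. k * (norm_sp h M (P j))\<^sup>2))"
      proof -
        \<comment> \<open>The shifted sum runs over levels \<open>0\<close> to \<open>N - 1\<close>;
          the missing last level is non-negative.\<close>
        have "(\<Sum>j = 1..N. k * (Z (j - 1))\<^sup>2) \<le> (\<Sum>n = 0..N. k * (Z n)\<^sup>2)" for Z :: "nat \<Rightarrow> real"
        proof -
          have "(\<Sum>n = 0..N. k * (Z n)\<^sup>2) = k * (Z 0)\<^sup>2 + (\<Sum>j = 1..N. k * (Z j)\<^sup>2)"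
            by (simp add: sum.atLeast_Suc_atMost)
          moreover have "0 \<le> k * (Z N)\<^sup>2" using k(1) by simp
          ultimately show ?thesis using sum_shift_down[of "\<lambda>j. k * (Z j)\<^sup>2" N] by linarith
        qed
        then show ?thesis using T h by (intro mult_left_mono add_mono) auto
      qed
      \<comment> \<open>The sources leave the initial residual in \<open>Y\<^sup>2\<close>
        untouched; it is spent on \<open>G 0\<close>.\<close>
      finally have 1: "(\<Sum>j = 1..n. q j) \<le> 2 * (1 + T) * (Y\<^sup>2 - (norm_sp h M (P 0))\<^sup>2)"
        by (simp add: Y2 algebra_simps)
      have "G 0 = (norm_sp h M (P 0))\<^sup>2"
        unfolding G_def using norm_sp_cong[of M "e 0" "P 0" h] init by simp
      also have "\<dots> \<le> 2 * (1 + T) * (norm_sp h M (P 0))\<^sup>2"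
        using T by (simp add: mult_le_cancel_right1)
      finally show "G 0 + (\<Sum>j = 1..n. q j) \<le> 2 * (1 + T) * Y\<^sup>2"
        using 1 by (simp add: algebra_simps)
      show "0 \<le> G 0 + (\<Sum>j = 1..n. q j)"
        using T(2) k(1) h(1) by (intro add_nonneg_nonneg sum_nonneg) (auto simp: G_def q_def)
    qed auto
    finally show ?thesis by (simp add: growth_def C_def mult_ac)
  qed
  have gr: "0 \<le> growth K T" using T by (simp add: growth_def)
  have m: "Max ((\<lambda>n. norm_sp h M (e n)) ` {0..N}) \<le> sqrt (growth K T) * Y"
  proof -
    have "norm_sp h M (e n) \<le> sqrt (growth K T) * Y" if "n \<le> N" for n
      by (rule power2_le_imp_le)
        (use G[OF that] \<open>0 \<le> Y\<close> gr in \<open>auto simp: G_def power_mult_distrib\<close>)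
    then show ?thesis by simp
  qed
  have l: "h * norm_star k N (\<lambda>n. e n 0) \<le> sqrt (2 * T * (1 + 2 * K\<^sup>2) * growth K T + 2) * Y"
  proof -
    have pt: "h\<^sup>2 * (e n 0)\<^sup>2 \<le> (1 + 2 * K\<^sup>2) * growth K T * Y\<^sup>2 + 2 * (P0 n)\<^sup>2" if n: "n \<le> N" for n
    proof -
      have "(e n 0)\<^sup>2 \<le> (1 + h) * (e n 0)\<^sup>2" using h by (simp add: mult_le_cancel_right1)
      also have "\<dots> \<le> (e n 1)\<^sup>2 + h * (b n + P0 n)\<^sup>2"
        using boundary_power2[OF h(1) left[OF n]] .
      finally have "h\<^sup>2 * (e n 0)\<^sup>2 \<le> h\<^sup>2 * ((e n 1)\<^sup>2 + h * (b n + P0 n)\<^sup>2)"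
        by (intro mult_left_mono) auto
      \<comment> \<open>One factor \<open>h\<close> makes \<open>(e n 1)\<^sup>2\<close> a summand
        of \<open>G n\<close>; the other powers of \<open>h\<close> are at most 1.\<close>
      also have "\<dots> = h * (h * (e n 1)\<^sup>2) + h ^ 3 * (b n + P0 n)\<^sup>2"
        by (simp add: algebra_simps power2_eq_square power3_eq_cube)
      also have "\<dots> \<le> 1 * G n + 1 * (2 * (K\<^sup>2 * G n) + 2 * (P0 n)\<^sup>2)"
      proof (intro add_mono mult_mono)
        have "(e n 1)\<^sup>2 \<le> (\<Sum>i = 1..M - 1. (e n i)\<^sup>2)"
          using M by (intro member_le_sum) auto
        then show "h * (e n 1)\<^sup>2 \<le> G n" using h by (simp add: G_def norm_sp_power2)
        have "(b n)\<^sup>2 \<le> K\<^sup>2 * G n"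
          using power_mono[OF b[OF n], of 2] by (simp add: G_def power_mult_distrib)
        then show "(b n + P0 n)\<^sup>2 \<le> 2 * (K\<^sup>2 * G n) + 2 * (P0 n)\<^sup>2"
          using power2_sum_le[of "b n" "P0 n"] by simp
        show "h ^ 3 \<le> 1" using h by (simp add: power_le_one)
      qed (use h in auto)
      also have "\<dots> = (1 + 2 * K\<^sup>2) * G n + 2 * (P0 n)\<^sup>2" by (simp add: algebra_simps)
      also have "\<dots> \<le> (1 + 2 * K\<^sup>2) * (growth K T * Y\<^sup>2) + 2 * (P0 n)\<^sup>2"
        using G[OF n] by (intro add_mono mult_left_mono) auto
      finally show ?thesis by (simp add: mult_ac)
    qed
    have "(h * norm_star k N (\<lambda>n. e n 0))\<^sup>2 = (\<Sum>n = 0..N. k * (h\<^sup>2 * (e n 0)\<^sup>2))"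
      using k(1) by (simp add: power_mult_distrib norm_star_power2 sum_distrib_left mult_ac)
    also have "\<dots> \<le> (\<Sum>n = 0..N. k * ((1 + 2 * K\<^sup>2) * growth K T * Y\<^sup>2 + 2 * (P0 n)\<^sup>2))"
      using pt k(1) by (intro sum_mono mult_left_mono) auto
    \<comment> \<open>There are \<open>N + 1\<close> time levels, so the constant part sums to
      \<open>T + k\<close>, which is at most \<open>2 * T\<close>.\<close>
    also have "\<dots> = (T + k) * ((1 + 2 * K\<^sup>2) * growth K T * Y\<^sup>2) + 2 * (\<Sum>n = 0..N. k * (P0 n)\<^sup>2)"
      by (simp add: sum.distrib sum_distrib_left T algebra_simps)
    also have "\<dots> \<le> (2 * T) * ((1 + 2 * K\<^sup>2) * growth K T * Y\<^sup>2) + 2 * Y\<^sup>2"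
      using kT gr pos by (intro add_mono mult_right_mono) (auto simp: Y2)
    also have "\<dots> = (sqrt (2 * T * (1 + 2 * K\<^sup>2) * growth K T + 2) * Y)\<^sup>2"
    proof -
      have "0 \<le> 2 * T * (1 + 2 * K\<^sup>2) * growth K T + 2" using T(2) gr by simp
      then show ?thesis by (simp only: power_mult_distrib real_sqrt_pow2) algebra
    qed
    finally show ?thesis
      by (rule power2_le_imp_le) (use \<open>0 \<le> Y\<close> gr T in auto)
  qed
  have u: "h * norm_star k N (\<lambda>n. e n M) \<le> Y"
  proof -
    have eM: "e n M = h * PM n" if "n \<le> N" for n using right[OF that] h by (simp add: field_simps)
    have "(norm_star k N (\<lambda>n. e n M))\<^sup>2 = h\<^sup>2 * (\<Sum>n = 0..N. k * (PM n)\<^sup>2)"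
      unfolding norm_star_power2[OF less_imp_le[OF k(1)]] sum_distrib_left
      by (intro sum.cong) (auto simp: eM power_mult_distrib)
    then have "(h * norm_star k N (\<lambda>n. e n M))\<^sup>2 = h\<^sup>2 * (h\<^sup>2 * (\<Sum>n = 0..N. k * (PM n)\<^sup>2))"
      by (simp only: power_mult_distrib)
    \<comment> \<open>One \<open>h\<close> is the weight of \<open>PM\<close> in
      \<open>norm_Y\<close>; the remaining \<open>h ^ 3\<close> is at most 1.\<close>
    also have "\<dots> = h ^ 3 * (h * (\<Sum>n = 0..N. k * (PM n)\<^sup>2))"
      by (simp add: power2_eq_square power3_eq_cube)
    also have "\<dots> \<le> 1 * (h * (\<Sum>n = 0..N. k * (PM n)\<^sup>2))"
      using pos h by (intro mult_right_mono) (auto simp: power_le_one)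
    also have "\<dots> \<le> Y\<^sup>2" using pos by (simp add: Y2)
    finally show ?thesis using \<open>0 \<le> Y\<close> by (rule power2_le_imp_le)
  qed
  have "norm_X h k M N (\<lambda>n. e n 0, e, \<lambda>n. e n M)
    = h * norm_star k N (\<lambda>n. e n 0) + h * norm_star k N (\<lambda>n. e n M)
      + Max ((\<lambda>n. norm_sp h M (e n)) ` {0..N})"
    by (simp add: distrib_left)
  also have "\<dots> \<le> sqrt (2 * T * (1 + 2 * K\<^sup>2) * growth K T + 2) * Y + Y + sqrt (growth K T) * Y"
    using m l u by (intro add_mono)
  finally show ?thesis
    unfolding stability_const_def Y_def[symmetric] by (simp only: distrib_right mult_1_left)
qed

section \<open>The nonlinear scheme on the ball around the nodal values\<close>

text \<open>Triangle inequality through the nodal values of \<open>u\<close>; the maximum in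
  \<open>norm_X\<close> controls the distance at each time level.\<close>

lemma ball_X_norm_sp_le:
  assumes h: "0 \<le> h" "0 \<le> k" "real M * h \<le> a" and U: "0 \<le> c"
    and u: "\<And>x. x \<in> {0..a} \<Longrightarrow> \<bar>u x (real n * k)\<bar> \<le> c"
    and V: "V \<in> ball_X h k M N (nodal_values a u h k) \<rho>" and n: "n \<le> N"
  shows "norm_sp h M (node M V n) \<le> \<rho> + sqrt a * c"
proof -
  obtain V0 V1 VM where VV: "V = (V0, V1, VM)" by (cases V)
  let ?d = "\<lambda>i. V1 n i - u (real i * h) (real n * k)"
  have star: "0 \<le> norm_star k N Z" for Z
    using h by (simp add: norm_star_def sum_nonneg)
  have "norm_sp h M ?d \<le> Max ((\<lambda>n. norm_sp h M (\<lambda>i. V1 n i - u (real i * h) (real n * k))) ` {0..N})"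
    using n by (intro Max_ge) auto
  also have "\<dots> \<le> norm_X h k M N (V - nodal_values a u h k)"
    using h star by (simp add: VV nodal_values_def minus_prod_def fun_diff_def)
  also have "\<dots> < \<rho>" using V by (simp add: ball_X_def)
  finally have d: "norm_sp h M ?d < \<rho>" .
  have "norm_sp h M (node M V n) = norm_sp h M (\<lambda>i. ?d i + u (real i * h) (real n * k))"
    by (intro norm_sp_cong) (auto simp: VV)
  also have "\<dots> \<le> norm_sp h M ?d + norm_sp h M (\<lambda>i. u (real i * h) (real n * k))"
    using h by (intro norm_sp_add)
  also have "norm_sp h M (\<lambda>i. u (real i * h) (real n * k)) \<le> sqrt a * c"
    using h U by (intro norm_sp_bound u grid_point_mem[where M = M]) auto
  finally show ?thesis using d by simp
qed

text \<open>The difference of two images under \<open>Phi\<close> is the residual of the linear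
  scheme for \<open>V - W\<close> with the nonlocal differences as sources; \<open>u0\<close>
  cancels. In the constant, \<open>8 * sqrt a\<close> comes from the outer quadrature at the
  boundary, and the added 1 covers the reaction term.\<close>

lemma Phi_stability:
  fixes d B :: "real \<Rightarrow> real \<Rightarrow> real"
  assumes h: "0 < h" "h \<le> 1" and k: "0 < k" "k = r * h\<^sup>2" "k = lam * h" "lam + 2 * r \<le> 1"
    and a: "a = real (cells M') * h" and T: "T = real N * k" "0 < T" and K: "0 \<le> K"
    and b: "\<And>n. n \<le> N \<Longrightarrow> norm_sp h (cells M')
        (\<lambda>i. B (real i * h) (Qh h M' (\<lambda>j. \<psi>2 (real j * h) * node (cells M') V n j)) * node (cells M') V n i
           - B (real i * h) (Qh h M' (\<lambda>j. \<psi>2 (real j * h) * node (cells M') W n j)) * node (cells M') W n i)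
      \<le> K * norm_sp h (cells M') (\<lambda>i. node (cells M') V n i - node (cells M') W n i)"
    and D: "\<And>n. n \<le> N \<Longrightarrow> norm_sp h (cells M')
        (\<lambda>i. d (real i * h) (Qh h M' (\<lambda>j. \<psi>1 (real j * h) * node (cells M') V n j)) * node (cells M') V n i
           - d (real i * h) (Qh h M' (\<lambda>j. \<psi>1 (real j * h) * node (cells M') W n j)) * node (cells M') W n i)
      \<le> K * norm_sp h (cells M') (\<lambda>i. node (cells M') V n i - node (cells M') W n i)"
  shows "norm_X h k (cells M') N (V - W)
    \<le> stability_const ((8 * sqrt a + 1) * K) T * norm_Y h k (cells M') N
      (Phi d B \<psi>1 \<psi>2 u0 h k M' V - Phi d B \<psi>1 \<psi>2 u0 h k M' W)"
proof -
  define M where "M = cells M'"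
  define v where "v = node M V"
  define w where "w = node M W"
  define e where "e n i = v n i - w n i" for n i
  define F where "F f \<psi> n = (\<lambda>i. f (real i * h) (Qh h M' (\<lambda>j. \<psi> (real j * h) * v n j)) * v n i
    - f (real i * h) (Qh h M' (\<lambda>j. \<psi> (real j * h) * w n j)) * w n i)" for f \<psi> n
  define P0 where "P0 n = (1 + 1 / h) * e n 0 - 1 / h * e n 1 - Qh h M' (F B \<psi>2 n)" for n
  define P where "P n i = (if n = 0 then e 0 i else (e n i - e (n - 1) i) / k
      + (e (n - 1) i - e (n - 1) (i - 1)) / h + F d \<psi>1 (n - 1) i
      - (e (n - 1) (i + 1) + e (n - 1) (i - 1) - 2 * e (n - 1) i) / h\<^sup>2)" for n i
  define PM where "PM n = e n M / h" for n
  have Phi: "Phi d B \<psi>1 \<psi>2 u0 h k M' V - Phi d B \<psi>1 \<psi>2 u0 h k M' W = (P0, P, PM)"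
    unfolding Phi_def Let_def minus_prod_def fst_conv snd_conv prod.inject
    using Qh_diff[of h M' "\<lambda>i. B (real i * h) (Qh h M' (\<lambda>j. \<psi>2 (real j * h) * v n j)) * v n i"
        "\<lambda>i. B (real i * h) (Qh h M' (\<lambda>j. \<psi>2 (real j * h) * w n j)) * w n i" for n]
    by (auto simp: fun_eq_iff P0_def P_def PM_def F_def e_def algebra_simps
          diff_divide_distrib add_divide_distrib simp flip: M_def v_def w_def)
  have M: "2 \<le> M" by (simp add: M_def cells_def)
  have "norm_X h k M N (\<lambda>n. e n 0, e, \<lambda>n. e n M)
    \<le> stability_const ((8 * sqrt a + 1) * K) T * norm_Y h k M N (P0, P, PM)"
  proof (rule scheme_stability[OF h k T M, where b = "\<lambda>n. Qh h M' (F B \<psi>2 n)" and D = "F d \<psi>1"])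
    have "0 \<le> a" using a h by simp
    then show "0 \<le> (8 * sqrt a + 1) * K" using K by simp
    fix n assume n: "n \<le> N"
    have E: "0 \<le> K * norm_sp h M (e n)" using h K by (simp add: norm_sp_nonneg)
    have "\<bar>Qh h M' (F B \<psi>2 n)\<bar> \<le> 8 * sqrt a * norm_sp h M (F B \<psi>2 n)"
      unfolding M_def using h a by (intro abs_Qh_le_norm_sp) auto
    also have "\<dots> \<le> 8 * sqrt a * (K * norm_sp h M (e n))"
      using b[OF n] \<open>0 \<le> a\<close> unfolding F_def e_def v_def w_def M_def by (intro mult_left_mono) auto
    finally show "\<bar>Qh h M' (F B \<psi>2 n)\<bar> \<le> (8 * sqrt a + 1) * K * norm_sp h M (e n)"
      using \<open>0 \<le> a\<close> E by (simp add: algebra_simps)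
    have "norm_sp h M (F d \<psi>1 n) \<le> K * norm_sp h M (e n)"
      using D[OF n] unfolding F_def e_def v_def w_def M_def .
    also have "\<dots> \<le> (8 * sqrt a + 1) * K * norm_sp h M (e n)"
      using \<open>0 \<le> a\<close> E K h by (simp add: algebra_simps norm_sp_nonneg)
    finally show "norm_sp h M (F d \<psi>1 n) \<le> (8 * sqrt a + 1) * K * norm_sp h M (e n)" .
  qed (auto simp: P0_def P_def PM_def)
  moreover have "norm_X h k M N (V - W) = norm_X h k M N (\<lambda>n. e n 0, e, \<lambda>n. e n M)"
  proof -
    obtain V0 V1 VM W0 W1 WM where VW: "V = (V0, V1, VM)" "W = (W0, W1, WM)"
      by (cases V, cases W)
    \<comment> \<open>The norm sees only interior indices, where \<open>node\<close> returns the
      middle component.\<close>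
    have "norm_sp h M (V1 n - W1 n) = norm_sp h M (e n)" for n
      by (intro norm_sp_cong) (auto simp: e_def v_def w_def VW)
    then show ?thesis
      using M by (simp add: VW minus_prod_def e_def v_def w_def fun_diff_def)
  qed
  ultimately show ?thesis by (simp add: Phi flip: M_def)
qed

theorem theorem3p2:
  fixes a T L R :: real
    and d B u :: "real \<Rightarrow> real \<Rightarrow> real"
    and \<psi>1 \<psi>2 u0 :: "real \<Rightarrow> real"
  assumes "a > 0" and "T > 0"
    and "\<forall>x\<in>{0..a}. \<forall>s. d x s \<ge> 0"
    and "\<forall>x\<in>{0..a}. \<forall>s. B x s \<ge> 0"
    and "cont_diff2 1 {0..a} UNIV d" and "cont_diff2 1 {0..a} UNIV B"
    and "cont_diff1 {0..a} \<psi>1" and "cont_diff1 {0..a} \<psi>2"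
    and "solves_P a d B \<psi>1 \<psi>2 u0 u"
    and "cont_diff2_bounded 3 {0..a} {0..T} u"
    and "L > 0"
    and "\<forall>x\<in>{0..a}. \<forall>s1>0. \<forall>s2>0. \<bar>d x s1 - d x s2\<bar> \<le> L * \<bar>s1 - s2\<bar>"
    and "\<forall>x\<in>{0..a}. \<forall>s1>0. \<forall>s2>0. \<bar>B x s1 - B x s2\<bar> \<le> L * \<bar>s1 - s2\<bar>"
    and "R > 0"
  shows "\<exists>h0>0. \<exists>S>0. \<forall>h k r lam :: real. \<forall>M' N :: nat.
           0 < h \<and> h \<le> h0 \<and> 0 < k \<and> a = real (cells M') * h \<and> T = real N * k \<and>
           k = r * h\<^sup>2 \<and> k = lam * h \<and> lam + 2 * r \<le> 1 \<longrightarrow>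
           (\<forall>V \<in> ball_X h k (cells M') N (nodal_values a u h k) (R * h).
            \<forall>W \<in> ball_X h k (cells M') N (nodal_values a u h k) (R * h).
              norm_X h k (cells M') N (V - W)
              \<le> S * norm_Y h k (cells M') N
                    (Phi d B \<psi>1 \<psi>2 u0 h k M' V - Phi d B \<psi>1 \<psi>2 u0 h k M' W))"
proof -
  obtain D where D: "partials_upto 3 {0..a} {0..T} u D"
    using assms(10) unfolding cont_diff2_bounded_def by blast
  \<comment> \<open>Continuity on the compact rectangle bounds \<open>u\<close> at all grid
    nodes.\<close>
  obtain c where c: "0 < c" "\<And>x t. x \<in> {0..a} \<Longrightarrow> t \<in> {0..T} \<Longrightarrow> \<bar>D 0 0 x t\<bar> \<le> c"
    by (rule partials_upto_bounded[OF D, of 0 0 "{0..a}" "{0..T}"]) auto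
  have u: "\<bar>u x t\<bar> \<le> c" if "x \<in> {0..a}" "t \<in> {0..T}" for x t
    using c(2)[OF that] D that unfolding partials_upto_def by metis
  obtain c1 where c1: "0 \<le> c1" "\<And>x. x \<in> {0..a} \<Longrightarrow> \<bar>\<psi>1 x\<bar> \<le> c1"
    using cont_diff1_bounded[OF assms(7)] by blast
  obtain c2 where c2: "0 \<le> c2" "\<And>x. x \<in> {0..a} \<Longrightarrow> \<bar>\<psi>2 x\<bar> \<le> c2"
    using cont_diff1_bounded[OF assms(8)] by blast
  \<comment> \<open>A radius for all meshes at once: \<open>R * h \<le> R\<close> when
    \<open>h \<le> 1\<close>, and \<open>sqrt a * c\<close> bounds the nodal values of
    \<open>u\<close>.\<close>
  define \<rho> where "\<rho> = R + sqrt a * c"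
  have \<rho>: "0 \<le> \<rho>" using assms(1,14) c by (simp add: \<rho>_def)
  obtain K1 where K1: "0 \<le> K1"
    \<comment> \<open>This interval contains all quadratures with weight \<open>\<psi>1\<close> of
      grid functions of norm at most \<open>\<rho>\<close>.\<close>
    "\<And>x s. x \<in> {0..a} \<Longrightarrow> \<bar>s\<bar> \<le> 8 * sqrt a * c1 * \<rho> \<Longrightarrow> \<bar>d x s\<bar> \<le> K1"
    "\<And>x s s'. x \<in> {0..a} \<Longrightarrow> \<bar>s\<bar> \<le> 8 * sqrt a * c1 * \<rho> \<Longrightarrow> \<bar>s'\<bar> \<le> 8 * sqrt a * c1 * \<rho>
      \<Longrightarrow> \<bar>d x s - d x s'\<bar> \<le> K1 * \<bar>s - s'\<bar>"
    using cont_diff2_locally_lipschitz[OF assms(5)] by metis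
  obtain K2 where K2: "0 \<le> K2"
    "\<And>x s. x \<in> {0..a} \<Longrightarrow> \<bar>s\<bar> \<le> 8 * sqrt a * c2 * \<rho> \<Longrightarrow> \<bar>B x s\<bar> \<le> K2"
    "\<And>x s s'. x \<in> {0..a} \<Longrightarrow> \<bar>s\<bar> \<le> 8 * sqrt a * c2 * \<rho> \<Longrightarrow> \<bar>s'\<bar> \<le> 8 * sqrt a * c2 * \<rho>
      \<Longrightarrow> \<bar>B x s - B x s'\<bar> \<le> K2 * \<bar>s - s'\<bar>"
    using cont_diff2_locally_lipschitz[OF assms(6)] by metis
  define K where "K = max (K1 * (1 + 8 * sqrt a * c1 * \<rho>)) (K2 * (1 + 8 * sqrt a * c2 * \<rho>))"
  have K: "0 \<le> K"
    using K1(1) c1(1) \<rho> assms(1) by (auto simp: K_def le_max_iff_disj)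
  \<comment> \<open>Fixed before \<open>h\<close>, \<open>k\<close>, \<open>r\<close>,
    \<open>lam\<close>, \<open>M'\<close> and \<open>N\<close> are chosen, as the order of
    quantifiers demands.\<close>
  define S where "S = stability_const ((8 * sqrt a + 1) * K) T"
  have S: "0 < S"
    using assms(2) by (simp add: S_def stability_const_def growth_def add_nonneg_pos add_pos_nonneg)
  have "norm_X h k (cells M') N (V - W) \<le> S * norm_Y h k (cells M') N
      (Phi d B \<psi>1 \<psi>2 u0 h k M' V - Phi d B \<psi>1 \<psi>2 u0 h k M' W)"
    if h: "0 < h" "h \<le> 1" and k: "0 < k" and a: "a = real (cells M') * h" and T: "T = real N * k"
      and kh: "k = r * h\<^sup>2" "k = lam * h" "lam + 2 * r \<le> 1"
      and V: "V \<in> ball_X h k (cells M') N (nodal_values a u h k) (R * h)"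
      and W: "W \<in> ball_X h k (cells M') N (nodal_values a u h k) (R * h)"
    for h k r lam M' N V W
  proof -
    have ah: "0 \<le> h" "real (cells M') * h \<le> a" using h a by auto
    have bd: "norm_sp h (cells M') (node (cells M') Z n) \<le> \<rho>"
      if "Z \<in> ball_X h k (cells M') N (nodal_values a u h k) (R * h)" "n \<le> N" for Z n
    proof -
      \<comment> \<open>The lemma on spatial nodes, reused for the time grid.\<close>
      have "real n * k \<in> {0..T}"
        using that(2) k by (intro grid_point_mem[of k N]) (auto simp: T)
      then have "norm_sp h (cells M') (node (cells M') Z n) \<le> R * h + sqrt a * c"
        using ah k c(1) that by (intro ball_X_norm_sp_le[where u = u and k = k and N = N] u) auto
      also have "\<dots> \<le> \<rho>" using h assms(14) by (simp add: \<rho>_def mult_le_cancel_left1)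
      finally show ?thesis .
    qed
    have nn: "0 \<le> norm_sp h (cells M') Z" for Z using ah by (simp add: norm_sp_nonneg)
    show ?thesis
      unfolding S_def
    proof (rule Phi_stability[OF h k kh a T assms(2) K])
      fix n assume n: "n \<le> N"
      show "norm_sp h (cells M')
        (\<lambda>i. B (real i * h) (Qh h M' (\<lambda>j. \<psi>2 (real j * h) * node (cells M') V n j)) * node (cells M') V n i
           - B (real i * h) (Qh h M' (\<lambda>j. \<psi>2 (real j * h) * node (cells M') W n j)) * node (cells M') W n i)
      \<le> K * norm_sp h (cells M') (\<lambda>i. node (cells M') V n i - node (cells M') W n i)"
        by (rule order_trans[OF nonlocal_lipschitz[OF ah c2 bd[OF V n] bd[OF W n] K2(2,3,1)]])
          (auto simp: K_def intro!: mult_right_mono nn)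
      show "norm_sp h (cells M')
        (\<lambda>i. d (real i * h) (Qh h M' (\<lambda>j. \<psi>1 (real j * h) * node (cells M') V n j)) * node (cells M') V n i
           - d (real i * h) (Qh h M' (\<lambda>j. \<psi>1 (real j * h) * node (cells M') W n j)) * node (cells M') W n i)
      \<le> K * norm_sp h (cells M') (\<lambda>i. node (cells M') V n i - node (cells M') W n i)"
        by (rule order_trans[OF nonlocal_lipschitz[OF ah c1 bd[OF V n] bd[OF W n] K1(2,3,1)]])
          (auto simp: K_def intro!: mult_right_mono nn)
    qed
  qed
  \<comment> \<open>The threshold is \<open>h0 = 1\<close>, the bound on \<open>h\<close> assumed in
    the estimates.\<close>
  then show ?thesis
    using S by (intro exI[of _ "1::real"] exI[of _ S] conjI allI impI ballI) auto
qed

end
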